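(* The map $\Phi:Q\to Q$, $(\mathbf b,\mathbf f)\mapsto(\mathbf b,2\mathbf b-\mathbf f)$, which "flips" the bike frame about the back wheel, is a sub-Riemannian isometry of $Q$.
   Context: Fix $\ell>0$. $Q=\{(\mathbf b,\mathbf f)\in\mathbb R^2\times\mathbb R^2:\|\mathbf f-\mathbf b\|=\ell\}$ is the bicycle configuration space, a smooth 3-manifold. The rank 2 distribution $D\subset TQ$ (no-skid condition) is defined by: $(\dot{\mathbf b},\dot{\mathbf f})\in T_{(\mathbf b,\mathbf f)}Q$ belongs to $D_{(\mathbf b,\mathbf f)}$ if and only if $\dot{\mathbf b}$ is a multiple of $\mathbf f-\mathbf b$. $D$ carries the inner product obtained by pulling back the Euclidean metric of $\mathbb R^2$ by the front wheel projection $\pi_f(\mathbf b,\mathbf f)=\mathbf f$ and restricting to $D$, i.e. $\langle(\dot{\mathbf b},\dot{\mathbf f}),(\dot{\mathbf b}',\dot{\mathbf f}')\rangle=\dot{\mathbf f}\cdot\dot{\mathbf f}'$. A sub-Riemannian isometry of $Q$ is a diffeomorphism of $Q$ that preserves $D$ and the inner product on it. *)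

theory Defs
  imports "HOL-Analysis.Analysis"
begin

text \<open>
  C^k maps on an open set. In the successor clause the directional derivatives in all
  directions are required to be C^k; as the domain is finite-dimensional, this says that the
  Frechet derivative is a C^k map into the space of linear maps.
\<close>

primrec Ck_on :: "nat \<Rightarrow> 'a::euclidean_space set \<Rightarrow> ('a \<Rightarrow> 'b::euclidean_space) \<Rightarrow> bool" where
  "Ck_on 0 U f \<longleftrightarrow> continuous_on U f"
| "Ck_on (Suc k) U f \<longleftrightarrow>
     (\<forall>x\<in>U. f differentiable (at x)) \<and> (\<forall>v. Ck_on k U (\<lambda>x. frechet_derivative f (at x) v))"

definition smooth_on_open :: "'a::euclidean_space set \<Rightarrow> ('a \<Rightarrow> 'b::euclidean_space) \<Rightarrow> bool" where
  "smooth_on_open U f \<longleftrightarrow> open U \<and> (\<forall>k. Ck_on k U f)"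

text \<open>
  Smooth submanifolds are represented as subsets of a Euclidean space. A map between them is
  smooth if it extends locally to a smooth map on an open subset of the ambient space.
\<close>

definition smooth_map ::
  "'a::euclidean_space set \<Rightarrow> 'b::euclidean_space set \<Rightarrow> ('a \<Rightarrow> 'b) \<Rightarrow> bool" where
  "smooth_map S T F \<longleftrightarrow> F ` S \<subseteq> T \<and>
     (\<forall>p\<in>S. \<exists>U G. p \<in> U \<and> smooth_on_open U G \<and> (\<forall>x\<in>S \<inter> U. G x = F x))"

definition diffeomorphism ::
  "'a::euclidean_space set \<Rightarrow> 'b::euclidean_space set \<Rightarrow> ('a \<Rightarrow> 'b) \<Rightarrow> bool" where
  "diffeomorphism S T F \<longleftrightarrow>
     bij_betw F S T \<and> smooth_map S T F \<and> smooth_map T S (inv_into S F)"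

definition smooth_curve_through ::
  "'a::euclidean_space set \<Rightarrow> 'a \<Rightarrow> (real \<Rightarrow> 'a) \<Rightarrow> bool" where
  "smooth_curve_through S p \<gamma> \<longleftrightarrow>
     \<gamma> 0 = p \<and> (\<exists>\<epsilon>>0. smooth_on_open {-\<epsilon><..<\<epsilon>} \<gamma> \<and> \<gamma> ` {-\<epsilon><..<\<epsilon>} \<subseteq> S)"

definition tangent_space :: "'a::euclidean_space set \<Rightarrow> 'a \<Rightarrow> 'a set" where
  "tangent_space S p =
     {v. \<exists>\<gamma>. smooth_curve_through S p \<gamma> \<and> (\<gamma> has_vector_derivative v) (at 0)}"

text \<open>
  The differential at p, computed on velocities of curves in S. It is meaningful for F smooth
  on S and v tangent to S at p; then the value does not depend on the choice of the curve.
\<close>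

definition differential ::
  "'a::euclidean_space set \<Rightarrow> ('a \<Rightarrow> 'b::euclidean_space) \<Rightarrow> 'a \<Rightarrow> 'a \<Rightarrow> 'b" where
  "differential S F p v =
     (THE w. \<exists>\<gamma>. smooth_curve_through S p \<gamma> \<and> (\<gamma> has_vector_derivative v) (at 0) \<and>
                 ((F \<circ> \<gamma>) has_vector_derivative w) (at 0))"

text \<open>A bicycle configuration is the pair of the back and the front wheel contact points.\<close>

type_synonym config = "(real^2) \<times> (real^2)"

definition bicycle_space :: "real \<Rightarrow> config set" where
  "bicycle_space l = {(b, f). norm (f - b) = l}"

definition no_skid :: "real \<Rightarrow> config \<Rightarrow> config set" where
  "no_skid l p =
     {v \<in> tangent_space (bicycle_space l) p. \<exists>c. fst v = c *\<^sub>R (snd p - fst p)}"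

text \<open>
  The pull-back of the Euclidean inner product along the front wheel projection \<open>snd\<close>, which is
  linear and hence its own differential. It is an inner product only on the subspaces
  \<open>no_skid l p\<close>.
\<close>

definition front_inner :: "config \<Rightarrow> config \<Rightarrow> real" where
  "front_inner v w = snd v \<bullet> snd w"

definition subriemannian_isometry :: "real \<Rightarrow> (config \<Rightarrow> config) \<Rightarrow> bool" where
  "subriemannian_isometry l F \<longleftrightarrow>
     diffeomorphism (bicycle_space l) (bicycle_space l) F \<and>
     (\<forall>p\<in>bicycle_space l.
        differential (bicycle_space l) F p ` no_skid l p = no_skid l (F p) \<and>
        (\<forall>v\<in>no_skid l p. \<forall>w\<in>no_skid l p.
           front_inner (differential (bicycle_space l) F p v)
             (differential (bicycle_space l) F p w) = front_inner v w))"

end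

theory Submission
  imports Defs
begin

text \<open>
  The flip is a linear involution of the ambient space that preserves the length of the frame, so
  its differential is the flip itself. If the back wheel moves along the frame, then its velocity
  \<open>b'\<close> is orthogonal to \<open>w = f' - b'\<close>, because the frame has constant length. The flip
  turns \<open>f' = b' + w\<close> into \<open>b' - w\<close>, which does not change inner products.
\<close>

text \<open>Frechet derivatives are local, so on an open set equal functions have equal directional
  derivatives at every order. This allows a derivative to be replaced by a formula that is valid on
  \<open>U\<close> only.\<close>

lemma Ck_on_cong:
  assumes "open U" "Ck_on k U f" "\<And>x. x \<in> U \<Longrightarrow> f x = g x"
  shows "Ck_on k U g"
  using assms(2,3)
proof (induction k arbitrary: f g)
  case 0
  then show ?case
    using continuous_on_cong[of U U f g] by simp
next
  case (Suc k)
  have deriv: "(g has_derivative frechet_derivative f (at x)) (at x)" if "x \<in> U" for x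
  proof -
    have "(f has_derivative frechet_derivative f (at x)) (at x)"
      using Suc.prems(1) that by (simp add: frechet_derivative_works)
    then show ?thesis
      using has_derivative_transform_within_open[OF _ \<open>open U\<close> that] Suc.prems(2) by blast
  qed
  then have eq: "frechet_derivative f (at x) v = frechet_derivative g (at x) v" if "x \<in> U" for x v
    using frechet_derivative_at that by metis
  have "Ck_on k U (\<lambda>x. frechet_derivative g (at x) v)" for v
    using Suc.IH[of "\<lambda>x. frechet_derivative f (at x) v"] Suc.prems(1) eq by simp
  moreover have "\<forall>x\<in>U. g differentiable (at x)"
    using deriv by (auto simp: differentiable_def)
  ultimately show ?case
    by simp
qed

lemma Ck_on_const: "Ck_on k U (\<lambda>x. c)"
  by (induction k arbitrary: c) (auto simp: frechet_derivative_const)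

lemma frechet_derivative_bounded_linear:
  "bounded_linear L \<Longrightarrow> frechet_derivative L (at x) = L"
  by (metis bounded_linear_imp_has_derivative frechet_derivative_at)

text \<open>A single differentiation makes the map constant in the base point, so a case distinction
  on \<open>k\<close> takes the place of an induction.\<close>

lemma Ck_on_bounded_linear:
  assumes "bounded_linear L"
  shows "Ck_on k U L"
proof (cases k)
  case 0
  then show ?thesis
    using assms by (simp add: linear_continuous_on)
next
  case (Suc n)
  then show ?thesis
    using assms
    by (simp add: frechet_derivative_bounded_linear Ck_on_const bounded_linear_imp_differentiable)
qed

text \<open>By the chain rule, a directional derivative of \<open>L \<circ> f\<close> is
  \<open>L\<close> composed with one of \<open>f\<close>. The form recurs, so induction on
  \<open>k\<close> works once \<open>f\<close> is generalized.\<close>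

lemma Ck_on_bounded_linear_compose:
  assumes "open U" "bounded_linear L" "Ck_on k U f"
  shows "Ck_on k U (L \<circ> f)"
  using assms(3)
proof (induction k arbitrary: f)
  case 0
  then show ?case
    using bounded_linear.continuous_on[OF assms(2)] by (simp add: o_def)
next
  case (Suc k)
  have deriv: "(L \<circ> f has_derivative L \<circ> frechet_derivative f (at x)) (at x)" if "x \<in> U" for x
  proof -
    have "(f has_derivative frechet_derivative f (at x)) (at x)"
      using Suc.prems that by (simp add: frechet_derivative_works)
    from bounded_linear.has_derivative[OF assms(2) this] show ?thesis
      by (simp add: o_def)
  qed
  have "Ck_on k U (\<lambda>x. frechet_derivative (L \<circ> f) (at x) v)" for v
  proof (rule Ck_on_cong[OF \<open>open U\<close>])
    show "Ck_on k U (L \<circ> (\<lambda>x. frechet_derivative f (at x) v))"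
      using Suc.prems by (intro Suc.IH) simp
    show "(L \<circ> (\<lambda>x. frechet_derivative f (at x) v)) x = frechet_derivative (L \<circ> f) (at x) v"
      if "x \<in> U" for x
      using frechet_derivative_at[OF deriv[OF that]] by (metis comp_apply)
  qed
  moreover have "\<forall>x\<in>U. (L \<circ> f) differentiable (at x)"
    using deriv by (auto simp: differentiable_def)
  ultimately show ?case
    unfolding Ck_on.simps by blast
qed

text \<open>\<open>L\<close> itself is a global smooth extension. \<open>F\<close> is kept apart
  from \<open>L\<close> to cover \<open>inv_into S L\<close>, which is known to agree with
  \<open>L\<close> on \<open>S\<close> only.\<close>

lemma smooth_map_bounded_linear:
  assumes "bounded_linear L" "L ` S \<subseteq> T" "\<And>x. x \<in> S \<Longrightarrow> F x = L x"
  shows "smooth_map S T F"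
proof -
  have "smooth_on_open UNIV L"
    using assms(1) by (simp add: smooth_on_open_def Ck_on_bounded_linear)
  then show ?thesis
    unfolding smooth_map_def using assms(2,3)
    by (intro conjI ballI exI[of _ UNIV] exI[of _ L]) auto
qed

lemma diffeomorphism_linear_involution:
  assumes "bounded_linear L" "L ` S \<subseteq> S" "\<And>x. L (L x) = x"
  shows "diffeomorphism S S L"
proof -
  have bij: "bij_betw L S S"
    using assms by (intro bij_betw_byWitness[where f' = L]) auto
  then have "inv_into S L x = L x" if "x \<in> S" for x
    using that assms(2,3) by (intro inv_into_f_eq) (auto simp: bij_betw_def)
  then have "smooth_map S S (inv_into S L)"
    by (rule smooth_map_bounded_linear[OF assms(1,2)])
  moreover have "smooth_map S S L"
    using assms(1,2) by (rule smooth_map_bounded_linear) simp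
  ultimately show ?thesis
    using bij by (simp add: diffeomorphism_def)
qed

lemma smooth_curve_through_bounded_linear:
  assumes "bounded_linear L" "L ` S \<subseteq> T" "smooth_curve_through S p \<gamma>"
  shows "smooth_curve_through T (L p) (L \<circ> \<gamma>)"
proof -
  obtain \<epsilon> where "\<gamma> 0 = p" "\<epsilon> > 0" and smooth: "smooth_on_open {-\<epsilon><..<\<epsilon>} \<gamma>"
    and sub: "\<gamma> ` {-\<epsilon><..<\<epsilon>} \<subseteq> S"
    using assms(3) by (auto simp: smooth_curve_through_def)
  moreover have "smooth_on_open {-\<epsilon><..<\<epsilon>} (L \<circ> \<gamma>)"
    using smooth Ck_on_bounded_linear_compose[OF _ assms(1)] unfolding smooth_on_open_def by blast
  moreover have "(L \<circ> \<gamma>) ` {-\<epsilon><..<\<epsilon>} \<subseteq> T"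
    using sub assms(2) by auto
  ultimately show ?thesis
    unfolding smooth_curve_through_def by (metis comp_apply)
qed

lemma tangent_space_bounded_linear:
  assumes "bounded_linear L" "L ` S \<subseteq> T" "v \<in> tangent_space S p"
  shows "L v \<in> tangent_space T (L p)"
proof -
  obtain \<gamma> where "smooth_curve_through S p \<gamma>" "(\<gamma> has_vector_derivative v) (at 0)"
    using assms(3) by (auto simp: tangent_space_def)
  then have "smooth_curve_through T (L p) (L \<circ> \<gamma>)"
    "((L \<circ> \<gamma>) has_vector_derivative L v) (at 0)"
    using smooth_curve_through_bounded_linear[OF assms(1,2)]
      bounded_linear.has_vector_derivative[OF assms(1)] by (auto simp: o_def)
  then show ?thesis
    by (auto simp: tangent_space_def)
qed

text \<open>The definite description needs a curve with velocity \<open>v\<close>, which tangency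
  supplies, and a value independent of the curve: the chain rule forces \<open>L v\<close> for each
  of them.\<close>

lemma differential_bounded_linear:
  assumes "bounded_linear L" "v \<in> tangent_space S p"
  shows "differential S L p v = L v"
proof -
  have deriv: "((L \<circ> \<gamma>) has_vector_derivative L v) (at 0)"
    if "(\<gamma> has_vector_derivative v) (at 0)" for \<gamma>
    using bounded_linear.has_vector_derivative[OF assms(1) that] by (simp add: o_def)
  show ?thesis
    unfolding differential_def
  proof (rule the_equality)
    show "\<exists>\<gamma>. smooth_curve_through S p \<gamma> \<and> (\<gamma> has_vector_derivative v) (at 0) \<and>
        ((L \<circ> \<gamma>) has_vector_derivative L v) (at 0)"
      using assms(2) deriv by (auto simp: tangent_space_def)
  qed (use deriv vector_derivative_unique_at in blast)
qed

text \<open>Differentiate the constant squared frame length along a curve with velocity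
  \<open>v\<close>.\<close>

lemma tangent_space_bicycle_space_orthogonal:
  assumes "v \<in> tangent_space (bicycle_space l) p"
  shows "(snd p - fst p) \<bullet> (snd v - fst v) = 0"
proof -
  obtain \<gamma> \<epsilon> where \<gamma>: "\<gamma> 0 = p" "\<epsilon> > 0" "\<gamma> ` {-\<epsilon><..<\<epsilon>} \<subseteq> bicycle_space l"
    and v: "(\<gamma> has_vector_derivative v) (at 0)"
    using assms by (auto simp: tangent_space_def smooth_curve_through_def)
  define q where "q t = snd (\<gamma> t) - fst (\<gamma> t)" for t
  have q': "(q has_vector_derivative (snd v - fst v)) (at 0)"
    unfolding q_def
    using bounded_linear.has_vector_derivative[OF bounded_linear_snd v]
      bounded_linear.has_vector_derivative[OF bounded_linear_fst v]
    by (rule has_vector_derivative_diff)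
  have "((\<lambda>t. q t \<bullet> q t) has_vector_derivative
      (q 0 \<bullet> (snd v - fst v) + (snd v - fst v) \<bullet> q 0)) (at 0)"
    by (rule bounded_bilinear.has_vector_derivative[OF bounded_bilinear_inner q' q'])
  moreover have "((\<lambda>t. q t \<bullet> q t) has_vector_derivative 0) (at 0)"
  \<comment> \<open>The length is known to be \<open>l\<close> only for parameters in the open
    interval around 0, which is enough for the derivative at 0.\<close>
  proof (rule has_vector_derivative_transform_within_open)
    show "((\<lambda>t. l\<^sup>2) has_vector_derivative 0) (at 0)"
      by simp
    show "l\<^sup>2 = q t \<bullet> q t" if "t \<in> {-\<epsilon><..<\<epsilon>}" for t
      using \<gamma>(3) that by (fastforce simp: q_def bicycle_space_def power2_norm_eq_inner)
  qed (use \<gamma>(2) in auto)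
  ultimately have "q 0 \<bullet> (snd v - fst v) + (snd v - fst v) \<bullet> q 0 = 0"
    by (rule vector_derivative_unique_at)
  then show ?thesis
    using \<gamma>(1) by (simp add: q_def inner_commute)
qed

definition flip :: "config \<Rightarrow> config" where
  "flip = (\<lambda>(b, f). (b, 2 *\<^sub>R b - f))"

lemma flip_simp [simp]: "flip p = (fst p, 2 *\<^sub>R fst p - snd p)"
  by (simp add: flip_def case_prod_beta)

lemma flip_flip: "flip (flip p) = p"
  by simp

lemma bounded_linear_flip: "bounded_linear flip"
  by (intro linear_conv_bounded_linear[THEN iffD1] linearI)
    (simp_all add: algebra_simps)

text \<open>The flip only reverses the sign of the frame vector.\<close>

lemma flip_bicycle_space: "flip ` bicycle_space l \<subseteq> bicycle_space l"
proof -
  have "norm (2 *\<^sub>R b - f - b) = norm (f - b)" for b f :: "real^2"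
    by (simp add: scaleR_2 norm_minus_commute)
  then show ?thesis
    by (auto simp: bicycle_space_def)
qed

text \<open>The back wheel velocity is unchanged while the frame vector is negated, so the factor
  \<open>c\<close> becomes \<open>-c\<close>. Tangency is preserved because the flip is linear and
  maps the space into itself.\<close>

lemma flip_no_skid:
  assumes "v \<in> no_skid l p"
  shows "flip v \<in> no_skid l (flip p)"
proof -
  obtain c where "fst v = c *\<^sub>R (snd p - fst p)"
    and "v \<in> tangent_space (bicycle_space l) p"
    using assms by (auto simp: no_skid_def)
  moreover from this have "fst (flip v) = (-c) *\<^sub>R (snd (flip p) - fst (flip p))"
    by (simp add: algebra_simps scaleR_2)
  ultimately show ?thesis
    using tangent_space_bounded_linear[OF bounded_linear_flip flip_bicycle_space]
    unfolding no_skid_def by blast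
qed

lemma front_inner_flip:
  assumes "v \<in> no_skid l p" "w \<in> no_skid l p"
  shows "front_inner (flip v) (flip w) = front_inner v w"
proof -
  \<comment> \<open>Two different vectors at the same \<open>p\<close> are allowed here:
    \<open>fst x\<close> is parallel to the frame and \<open>snd y - fst y\<close> is orthogonal to
    it. Hence both cross terms vanish when \<open>fst v \<plusminus> (snd v - fst v)\<close> is
    multiplied by the same expression in \<open>w\<close>.\<close>
  have orth: "fst x \<bullet> (snd y - fst y) = 0" if "x \<in> no_skid l p" "y \<in> no_skid l p" for x y
    using that tangent_space_bicycle_space_orthogonal[of y l p] by (auto simp: no_skid_def)
  show ?thesis
    using orth[OF assms] orth[OF assms(2,1)]
    by (simp add: front_inner_def inner_diff_left inner_diff_right inner_commute)
qed

theorem lemma3p2: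
  fixes l :: real
  assumes "l > 0"
  shows "subriemannian_isometry l (\<lambda>(b, f). (b, 2 *\<^sub>R b - f))"
proof -
  let ?Q = "bicycle_space l"
  have diff: "differential ?Q flip p v = flip v" if "v \<in> no_skid l p" for p v
    using that by (simp add: no_skid_def differential_bounded_linear[OF bounded_linear_flip]
        del: flip_simp)
  have "differential ?Q flip p ` no_skid l p = no_skid l (flip p)" for p
  proof -
    have "flip ` no_skid l p = no_skid l (flip p)"
    proof
      show "flip ` no_skid l p \<subseteq> no_skid l (flip p)"
        using flip_no_skid by blast
      show "no_skid l (flip p) \<subseteq> flip ` no_skid l p"
        \<comment> \<open>Apply the inclusion at the base point \<open>flip p\<close>: the flip of a
          vector there is a preimage in \<open>no_skid l p\<close>, since flipping twice is the
          identity.\<close>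
        using flip_no_skid[of _ l "flip p"] unfolding flip_flip
        by (metis flip_flip imageI subsetI)
    qed
    moreover have "differential ?Q flip p ` no_skid l p = flip ` no_skid l p"
      using diff by (rule image_cong[OF refl])
    ultimately show ?thesis
      by (rule trans[rotated])
  qed
  moreover have "front_inner (differential ?Q flip p v) (differential ?Q flip p w) = front_inner v w"
    if "v \<in> no_skid l p" "w \<in> no_skid l p" for p v w
    \<comment> \<open>Applications of \<open>flip\<close> must stay folded to match the left-hand
      side of \<open>front_inner_flip\<close>.\<close>
    using that by (simp add: diff front_inner_flip del: flip_simp)
  ultimately have "subriemannian_isometry l flip"
    unfolding subriemannian_isometry_def
    using diffeomorphism_linear_involution[OF bounded_linear_flip flip_bicycle_space flip_flip]
    by blast
  then show ?thesis
    by (simp only: flip_def)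
qed

end
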